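(* None of the following four-dimensional real Lie algebras (each of which admits a symplectic form) admits a para-Kähler structure (basis $e_1,\dots,e_4$, only nonvanishing brackets listed): - $\mathfrak{rr}'_{3,0}$: $[e_1,e_2]=-e_3$, $[e_1,e_3]=e_2$; - $\mathfrak n_4$: $[e_4,e_1]=e_2$, $[e_4,e_2]=e_3$; - $\mathfrak r'_{4,0,\delta}$ for any $\delta>0$: $[e_4,e_1]=e_1$, $[e_4,e_2]=-\delta e_3$, $[e_4,e_3]=\delta e_2$; - $\mathfrak d'_{4,\delta}$ for any $\delta>0$: $[e_1,e_2]=e_3$, $[e_4,e_1]=\frac{\delta}{2}e_1-e_2$, $[e_4,e_3]=\delta e_3$, $[e_4,e_2]=e_1+\frac{\delta}{2}e_2$.
   Context: A para-Kähler structure on an even-dimensional real Lie algebra $\mathfrak g$ is a pair $(\omega,K)$ where $\omega$ is a symplectic form on $\mathfrak g$ (a nondegenerate $2$-form with $\omega([u,v],w)+\omega([v,w],u)+\omega([w,u],v)=0$) and $K$ is an endomorphism with $K^2=\mathrm{Id}$ such that $\omega(Ku,v)=-\omega(u,Kv)$ for all $u,v$, and the eigenspaces $\ker(K-\mathrm{Id})$ and $\ker(K+\mathrm{Id})$ have equal dimension and are Lie subalgebras (they are then $\omega$-Lagrangian). *)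

theory Defs
  imports "HOL-Analysis.Analysis"
begin

text \<open>
  A finite-dimensional real vector space is a type of class \<open>euclidean_space\<close>; its inner product
  plays no role here. The Lie bracket on it is an explicit argument.
\<close>

locale lie_algebra =
  fixes br :: "'a::euclidean_space \<Rightarrow> 'a \<Rightarrow> 'a"
  assumes bilinear_br: "bilinear br"
    and br_self: "br u u = 0"
    and jacobi: "br u (br v w) + br v (br w u) + br w (br u v) = 0"

definition lie_subalgebra :: "('a::euclidean_space \<Rightarrow> 'a \<Rightarrow> 'a) \<Rightarrow> 'a set \<Rightarrow> bool" where
  "lie_subalgebra br S \<longleftrightarrow> subspace S \<and> (\<forall>u\<in>S. \<forall>v\<in>S. br u v \<in> S)"

definition symplectic_form ::
    "('a::euclidean_space \<Rightarrow> 'a \<Rightarrow> 'a) \<Rightarrow> ('a \<Rightarrow> 'a \<Rightarrow> real) \<Rightarrow> bool" where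
  "symplectic_form br \<omega> \<longleftrightarrow>
     bilinear \<omega> \<and> (\<forall>u. \<omega> u u = 0) \<and>
     (\<forall>u. (\<forall>v. \<omega> u v = 0) \<longrightarrow> u = 0) \<and>
     (\<forall>u v w. \<omega> (br u v) w + \<omega> (br v w) u + \<omega> (br w u) v = 0)"

text \<open>
  Evenness of the dimension is not a separate requirement: it is forced by nondegeneracy of \<open>\<omega>\<close>.
\<close>

definition para_kahler ::
    "('a::euclidean_space \<Rightarrow> 'a \<Rightarrow> 'a) \<Rightarrow> ('a \<Rightarrow> 'a \<Rightarrow> real) \<Rightarrow> ('a \<Rightarrow> 'a) \<Rightarrow> bool" where
  "para_kahler br \<omega> K \<longleftrightarrow>
     symplectic_form br \<omega> \<and>
     linear K \<and> K \<circ> K = id \<and>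
     (\<forall>u v. \<omega> (K u) v = - \<omega> u (K v)) \<and>
     dim {u. K u - u = 0} = dim {u. K u + u = 0} \<and>
     lie_subalgebra br {u. K u - u = 0} \<and>
     lie_subalgebra br {u. K u + u = 0}"

text \<open>
  The bilinear alternating bracket given by a list of nonvanishing brackets of basis vectors: an
  entry \<open>(i, j, w)\<close> stands for \<open>[e\<^sub>i, e\<^sub>j] = w\<close> (hence also \<open>[e\<^sub>j, e\<^sub>i] = - w\<close>). Each
  unordered pair \<open>{i, j}\<close> must occur at most once; pairs that do not occur have bracket zero.
\<close>

definition bracket_table ::
    "('n \<times> 'n \<times> (real ^ 'n)) list \<Rightarrow> real ^ 'n \<Rightarrow> real ^ 'n \<Rightarrow> real ^ 'n" where
  "bracket_table T u v = (\<Sum>(i, j, w)\<leftarrow>T. (u $ i * v $ j - u $ j * v $ i) *\<^sub>R w)"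

text \<open>In the index type \<open>4\<close> the numeral \<open>4\<close> denotes the same element as \<open>0\<close>.\<close>

abbreviation ee :: "4 \<Rightarrow> real ^ 4" where
  "ee i \<equiv> axis i 1"

definition rr'_3_0 :: "real ^ 4 \<Rightarrow> real ^ 4 \<Rightarrow> real ^ 4" where
  "rr'_3_0 = bracket_table [(1, 2, - ee 3), (1, 3, ee 2)]"

definition n_4 :: "real ^ 4 \<Rightarrow> real ^ 4 \<Rightarrow> real ^ 4" where
  "n_4 = bracket_table [(4, 1, ee 2), (4, 2, ee 3)]"

definition r'_4_0 :: "real \<Rightarrow> real ^ 4 \<Rightarrow> real ^ 4 \<Rightarrow> real ^ 4" where
  "r'_4_0 \<delta> = bracket_table [(4, 1, ee 1), (4, 2, - \<delta> *\<^sub>R ee 3), (4, 3, \<delta> *\<^sub>R ee 2)]"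

definition d'_4 :: "real \<Rightarrow> real ^ 4 \<Rightarrow> real ^ 4 \<Rightarrow> real ^ 4" where
  "d'_4 \<delta> = bracket_table
     [(1, 2, ee 3),
      (4, 1, (\<delta> / 2) *\<^sub>R ee 1 - ee 2),
      (4, 3, \<delta> *\<^sub>R ee 3),
      (4, 2, ee 1 + (\<delta> / 2) *\<^sub>R ee 2)]"

end

theory Submission
  imports Defs
begin

text \<open>
  In each of the four algebras there are a codimension-one ideal \<open>h = ker \<phi>\<close> and a vector \<open>z\<^sub>0 \<in> h\<close>
  such that \<open>ad u\<close>, for \<open>u \<notin> h\<close>, has on \<open>h\<close> only the real eigenline \<open>\<real>z\<^sub>0\<close>, while closedness of
  \<open>\<omega>\<close> forces \<open>\<omega>(h, z\<^sub>0) = 0\<close>, hence \<open>\<omega>(u, z\<^sub>0) \<noteq> 0\<close> for \<open>u \<notin> h\<close>. A two-dimensional subalgebra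
  \<open>L\<close> containing some \<open>u \<notin> h\<close> meets \<open>h\<close> in a line stable under \<open>ad u\<close>, that is in \<open>\<real>z\<^sub>0\<close>, so it is
  not Lagrangian. Thus every Lagrangian subalgebra lies in \<open>h\<close>, and two of them cannot be
  complementary.
\<close>

section \<open>Lagrangian subalgebras and para-Kaehler eigenspaces\<close>

lemma symplectic_form_antisym:
  assumes "symplectic_form br \<omega>"
  shows "\<omega> u v = - \<omega> v u"
proof -
  have bil: "bilinear \<omega>" and alt: "\<And>x. \<omega> x x = 0"
    using assms by (auto simp: symplectic_form_def)
  have "\<omega> (u + v) (u + v) = \<omega> u u + \<omega> u v + \<omega> v u + \<omega> v v"
    by (simp add: bilinear_ladd[OF bil] bilinear_radd[OF bil])
  then show ?thesis using alt[of u] alt[of v] alt[of "u + v"] by linarith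
qed

lemma lagrangian_subalgebra_le_ker:
  fixes br :: "'a::euclidean_space \<Rightarrow> 'a \<Rightarrow> 'a" and \<phi> :: "'a \<Rightarrow> real"
  assumes \<omega>: "symplectic_form br \<omega>"
    and \<phi>: "linear \<phi>" "\<And>u v. \<phi> (br u v) = 0"
    and z0: "\<And>v. \<phi> v = 0 \<Longrightarrow> \<omega> v z0 = 0" "z0 \<noteq> 0"
    and eigen: "\<And>u z c. \<phi> u \<noteq> 0 \<Longrightarrow> \<phi> z = 0 \<Longrightarrow> br u z = c *\<^sub>R z \<Longrightarrow> \<exists>k. z = k *\<^sub>R z0"
    and L: "lie_subalgebra br L" "dim L = 2" "\<And>u v. u \<in> L \<Longrightarrow> v \<in> L \<Longrightarrow> \<omega> u v = 0"
    and u: "u \<in> L"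
  shows "\<phi> u = 0"
proof (rule ccontr)
  assume \<phi>u: "\<phi> u \<noteq> 0"
  have sub: "subspace L" using L(1) by (simp add: lie_subalgebra_def)
  have bil: "bilinear \<omega>" using \<omega> by (simp add: symplectic_form_def)
  have "u \<noteq> 0" using \<phi>u linear_0[OF \<phi>(1)] by auto
  have "\<not> L \<subseteq> span {u}"
    using dim_subset[of L "span {u}"] dim_singleton[of u] L(2) by (auto split: if_splits)
  then obtain w where w: "w \<in> L" "w \<notin> span {u}" by blast
  \<comment> \<open>Projecting \<open>w\<close> along \<open>u\<close> onto the kernel of
    \<open>\<phi>\<close> gives a second basis vector of \<open>L\<close>, spanning the intersection
    of \<open>L\<close> with that kernel.\<close>
  define z where "z = w - (\<phi> w / \<phi> u) *\<^sub>R u"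
  have zL: "z \<in> L" unfolding z_def by (intro subspace_diff subspace_scale sub w u)
  have \<phi>z: "\<phi> z = 0"
    using \<phi>u by (simp add: z_def linear_diff[OF \<phi>(1)] linear_scale[OF \<phi>(1)])
  have "z \<notin> span {u}"
  proof
    assume "z \<in> span {u}"
    then have "z + (\<phi> w / \<phi> u) *\<^sub>R u \<in> span {u}"
      by (intro span_add span_scale[OF span_base]) auto
    then show False using w by (simp add: z_def)
  qed
  then have "z \<noteq> u" by (metis insertI1 span_base)
  then have ind: "independent {z, u}"
    using \<open>z \<notin> span {u}\<close> \<open>u \<noteq> 0\<close>
    by (intro independent_insertI) (simp_all add: independent_empty)
  have "z \<noteq> 0" using \<open>z \<notin> span {u}\<close> by (auto simp: span_zero)
  have "L \<subseteq> span {z, u}"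
    using card_eq_dim[of "{z, u}" L] ind L(2) zL u \<open>z \<noteq> u\<close> by auto
  moreover have "br u z \<in> L" using L(1) u zL by (simp add: lie_subalgebra_def)
  ultimately have "br u z \<in> span {z, u}" by blast
  then obtain a b where ab: "br u z = a *\<^sub>R z + b *\<^sub>R u"
    by (auto simp: span_insert diff_eq_eq add.commute)
  \<comment> \<open>Brackets lie in the kernel of \<open>\<phi>\<close>, so \<open>br u z\<close>
    has no \<open>u\<close>-component: \<open>z\<close> is an eigenvector of
    \<open>ad u\<close>.\<close>
  have "b = 0"
    using \<phi>(2)[of u z] \<phi>u \<phi>z
    by (simp add: ab linear_add[OF \<phi>(1)] linear_scale[OF \<phi>(1)])
  then obtain k where k: "z = k *\<^sub>R z0" using eigen[OF \<phi>u \<phi>z, of a] ab by auto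
  have "k * \<omega> u z0 = 0"
    using L(3)[OF u zL] by (simp add: k bilinear_rmul[OF bil])
  then have uz0: "\<omega> u z0 = 0" using k \<open>z \<noteq> 0\<close> by auto
  \<comment> \<open>Every \<open>v\<close> is a multiple of \<open>u\<close> plus a vector of the
    kernel, and both pair to zero with \<open>z0\<close>. Hence \<open>z0\<close> lies in the
    radical of \<omega>, against nondegeneracy.\<close>
  have "\<omega> v z0 = 0" for v
  proof -
    have "\<omega> (v - (\<phi> v / \<phi> u) *\<^sub>R u) z0 = 0"
      using \<phi>u by (intro z0) (simp add: linear_diff[OF \<phi>(1)] linear_scale[OF \<phi>(1)])
    then show ?thesis by (simp add: bilinear_lsub[OF bil] bilinear_lmul[OF bil] uz0)
  qed
  then have "\<omega> z0 v = 0" for v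
    using symplectic_form_antisym[OF \<omega>, of z0 v] by simp
  then have "z0 = 0" using \<omega> by (force simp: symplectic_form_def)
  then show False using z0 by simp
qed

text \<open>Since \<open>K\<close> is an involution, \<open>x = (x + K x)/2 + (x - K x)/2\<close>
  splits the space into the two eigenspaces, and equal dimensions make each one half. Isotropy comes
  from skewness of \<open>K\<close>: it gives \<open>s * \<omega> u v = - s * \<omega> u v\<close>.
  The sign \<open>s\<close> serves both eigenspaces at once.\<close>

lemma para_kahler_eigenspaces:
  fixes br :: "'a::euclidean_space \<Rightarrow> 'a \<Rightarrow> 'a"
  assumes pk: "para_kahler br \<omega> K" and s: "s = 1 \<or> s = - 1"
  shows "2 * dim {u. K u = s *\<^sub>R u} = DIM('a)"
    and "lie_subalgebra br {u. K u = s *\<^sub>R u}"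
    and "K u = s *\<^sub>R u \<Longrightarrow> K v = s *\<^sub>R v \<Longrightarrow> \<omega> u v = 0"
proof -
  let ?P = "{u. K u - u = 0}" and ?M = "{u. K u + u = 0}"
  have E: "{u. K u = s *\<^sub>R u} = (if s = 1 then ?P else ?M)"
    using s
  proof
    assume "s = - 1"
    then show ?thesis using eq_neg_iff_add_eq_0[of "K _"] by simp
  qed simp
  have K: "linear K" "\<And>x. K (K x) = x" "subspace ?P" "subspace ?M" "dim ?P = dim ?M"
    using pk by (auto simp: para_kahler_def lie_subalgebra_def dest: fun_cong)
  have "x \<in> {p + m |p m. p \<in> ?P \<and> m \<in> ?M}" for x
  proof -
    have "x = (1/2) *\<^sub>R (x + K x) + (1/2) *\<^sub>R (x - K x)"
      by (simp add: algebra_simps flip: scaleR_add_left)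
    moreover have "(1/2) *\<^sub>R (x + K x) \<in> ?P" "(1/2) *\<^sub>R (x - K x) \<in> ?M"
      by (simp_all add: linear_scale[OF K(1)] linear_add[OF K(1)] linear_diff[OF K(1)] K(2)
            algebra_simps)
    ultimately show ?thesis by blast
  qed
  then have "{p + m |p m. p \<in> ?P \<and> m \<in> ?M} = UNIV" by blast
  moreover have "?P \<inter> ?M = {0}"
  proof -
    have "x = 0" if "K x = x" "K x + x = 0" for x
      using that by (simp flip: scaleR_2)
    then show ?thesis using linear_0[OF K(1)] by auto
  qed
  ultimately have "dim ?P + dim ?M = DIM('a)"
    using dim_sums_Int[OF K(3,4)] by (simp add: dim_UNIV)
  with K(5) show "2 * dim {u. K u = s *\<^sub>R u} = DIM('a)" unfolding E by simp
  show "lie_subalgebra br {u. K u = s *\<^sub>R u}"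
    using pk unfolding E by (simp add: para_kahler_def)
  assume uv: "K u = s *\<^sub>R u" "K v = s *\<^sub>R v"
  have bil: "bilinear \<omega>" using pk by (simp add: para_kahler_def symplectic_form_def)
  have "\<omega> (K u) v = - \<omega> u (K v)" using pk by (simp add: para_kahler_def)
  then show "\<omega> u v = 0"
    using s by (auto simp: uv bilinear_lmul[OF bil] bilinear_rmul[OF bil])
qed

text \<open>The ideal is the hyperplane where coordinate \<open>i\<close> vanishes. Both eigenspaces
  would lie in it, although together they span the space. The condition on \<open>z0\<close> ranges
  over all symplectic forms because the para-Kaehler form is not known in advance.\<close>

lemma not_para_kahler_4:
  fixes br :: "real ^ 4 \<Rightarrow> real ^ 4 \<Rightarrow> real ^ 4"
  assumes z0: "\<And>\<omega> v. symplectic_form br \<omega> \<Longrightarrow> v $ i = 0 \<Longrightarrow> \<omega> v z0 = 0" "z0 \<noteq> 0"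
    and br: "\<And>u v. br u v $ i = 0"
    and eigen: "\<And>u z c. u $ i \<noteq> 0 \<Longrightarrow> z $ i = 0 \<Longrightarrow> br u z = c *\<^sub>R z \<Longrightarrow> \<exists>k. z = k *\<^sub>R z0"
  shows "\<not> (\<exists>\<omega> K. para_kahler br \<omega> K)"
proof safe
  fix \<omega> K assume pk: "para_kahler br \<omega> K"
  have \<omega>: "symplectic_form br \<omega>" and K: "linear K" "\<And>x. K (K x) = x"
    using pk by (auto simp: para_kahler_def dest: fun_cong)
  have ker: "u $ i = 0" if "K u = s *\<^sub>R u" and s: "s = 1 \<or> s = - 1" for u s
  proof (rule lagrangian_subalgebra_le_ker[where \<omega> = \<omega> and \<phi> = "\<lambda>x. x $ i"
        and L = "{u. K u = s *\<^sub>R u}"])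
    show "linear (\<lambda>x::real^4. x $ i)" by (simp add: bounded_linear.linear bounded_linear_vec_nth)
    show "dim {u. K u = s *\<^sub>R u} = 2" using para_kahler_eigenspaces(1)[OF pk s] by simp
    show "lie_subalgebra br {u. K u = s *\<^sub>R u}" by (rule para_kahler_eigenspaces(2)[OF pk s])
  qed (use \<omega> z0 br eigen that para_kahler_eigenspaces(3)[OF pk s] in auto)
  \<comment> \<open>These vectors belong to the eigenvalues 1 and -1; their sum is
    \<open>2 x\<close>, so coordinate \<open>i\<close> of every \<open>x\<close> would
    vanish.\<close>
  have "(x + K x) $ i = 0" "(x - K x) $ i = 0" for x
    by (rule ker[of _ 1] ker[of _ "-1"];
        simp add: linear_add[OF K(1)] linear_diff[OF K(1)] K(2))+
  from this[of "axis i 1"] show False by simp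
qed

section \<open>Bracket tables in coordinates and the Jacobi identity\<close>

lemma bilinear_bracket_table: "bilinear (bracket_table T)"
proof (induction T)
  case Nil
  then show ?case
    by (simp add: bracket_table_def bilinear_def linear_iff)
next
  case (Cons t T)
  obtain i j w where t: "t = (i, j, w)" by (cases t)
  show ?case
    using Cons unfolding t bracket_table_def bilinear_def linear_iff
    by (simp add: algebra_simps)
qed

lemma bracket_table_self: "bracket_table T u u = 0"
  by (induction T) (auto simp: bracket_table_def)

lemma lie_algebra_bracket_table:
  assumes "\<And>u v w. bracket_table T u (bracket_table T v w) + bracket_table T v (bracket_table T w u)
      + bracket_table T w (bracket_table T u v) = 0"
  shows "lie_algebra (bracket_table T)"
  using assms by unfold_locales (auto simp: bilinear_bracket_table bracket_table_self)

lemma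
  shows rr'_3_0_nth: "rr'_3_0 u v $ 1 = 0" "rr'_3_0 u v $ 2 = u $ 1 * v $ 3 - u $ 3 * v $ 1"
    "rr'_3_0 u v $ 3 = u $ 2 * v $ 1 - u $ 1 * v $ 2" "rr'_3_0 u v $ 4 = 0"
  and n_4_nth: "n_4 u v $ 1 = 0" "n_4 u v $ 2 = u $ 4 * v $ 1 - u $ 1 * v $ 4"
    "n_4 u v $ 3 = u $ 4 * v $ 2 - u $ 2 * v $ 4" "n_4 u v $ 4 = 0"
  and r'_4_0_nth: "r'_4_0 \<delta> u v $ 1 = u $ 4 * v $ 1 - u $ 1 * v $ 4"
    "r'_4_0 \<delta> u v $ 2 = \<delta> * (u $ 4 * v $ 3 - u $ 3 * v $ 4)"
    "r'_4_0 \<delta> u v $ 3 = - \<delta> * (u $ 4 * v $ 2 - u $ 2 * v $ 4)" "r'_4_0 \<delta> u v $ 4 = 0"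
  and d'_4_nth:
    "d'_4 \<delta> u v $ 1 = \<delta> / 2 * (u $ 4 * v $ 1 - u $ 1 * v $ 4) + (u $ 4 * v $ 2 - u $ 2 * v $ 4)"
    "d'_4 \<delta> u v $ 2 = \<delta> / 2 * (u $ 4 * v $ 2 - u $ 2 * v $ 4) - (u $ 4 * v $ 1 - u $ 1 * v $ 4)"
    "d'_4 \<delta> u v $ 3 = (u $ 1 * v $ 2 - u $ 2 * v $ 1) + \<delta> * (u $ 4 * v $ 3 - u $ 3 * v $ 4)"
    "d'_4 \<delta> u v $ 4 = 0"
  by (simp_all add: rr'_3_0_def n_4_def r'_4_0_def d'_4_def bracket_table_def axis_def algebra_simps)

lemmas bracket_nth = rr'_3_0_nth n_4_nth r'_4_0_nth d'_4_nth

lemma lie_algebra_rr'_3_0: "lie_algebra rr'_3_0"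
  unfolding rr'_3_0_def
  by (rule lie_algebra_bracket_table, simp only: rr'_3_0_def [symmetric])
     (simp add: bracket_nth vec_eq_iff forall_4 algebra_simps)

lemma lie_algebra_n_4: "lie_algebra n_4"
  unfolding n_4_def
  by (rule lie_algebra_bracket_table, simp only: n_4_def [symmetric])
     (simp add: bracket_nth vec_eq_iff forall_4 algebra_simps)

lemma lie_algebra_r'_4_0: "lie_algebra (r'_4_0 \<delta>)"
  unfolding r'_4_0_def
  by (rule lie_algebra_bracket_table, simp only: r'_4_0_def [symmetric])
     (simp add: bracket_nth vec_eq_iff forall_4 algebra_simps)

lemma lie_algebra_d'_4: "lie_algebra (d'_4 \<delta>)"
proof -
  \<comment> \<open>Writing \<delta> as \<open>2 * h\<close> clears the halves, so that the Jacobi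
    identity becomes a polynomial identity with integer coefficients.\<close>
  have "lie_algebra (d'_4 (2 * h))" for h
    unfolding d'_4_def
    by (rule lie_algebra_bracket_table, simp only: d'_4_def [symmetric])
       (simp add: bracket_nth vec_eq_iff forall_4 algebra_simps)
  from this[of "\<delta> / 2"] show ?thesis by simp
qed

section \<open>Explicit symplectic forms\<close>

text \<open>In the dual basis this is the 2-form \<open>e^i \<and> e^j + a e^k \<and> e^l\<close>;
  each of the four algebras has a symplectic form of this shape.\<close>

definition darboux_4 :: "4 \<Rightarrow> 4 \<Rightarrow> real \<Rightarrow> 4 \<Rightarrow> 4 \<Rightarrow> real ^ 4 \<Rightarrow> real ^ 4 \<Rightarrow> real" where
  "darboux_4 i j a k l u v =
    u $ i * v $ j - u $ j * v $ i + a * (u $ k * v $ l - u $ l * v $ k)"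

lemma symplectic_form_darboux_4:
  assumes "distinct [i, j, k, l]" "a \<noteq> 0"
    and "\<And>u v w. darboux_4 i j a k l (br u v) w + darboux_4 i j a k l (br v w) u
      + darboux_4 i j a k l (br w u) v = 0"
  shows "symplectic_form br (darboux_4 i j a k l)"
  unfolding symplectic_form_def
proof (intro conjI allI impI)
  show "bilinear (darboux_4 i j a k l)"
    by (simp add: darboux_4_def bilinear_def linear_iff algebra_simps)
  fix u assume u: "\<forall>v. darboux_4 i j a k l u v = 0"
  have "card {i, j, k, l} = card (UNIV :: 4 set)" using assms(1) by simp
  then have "{i, j, k, l} = UNIV" by (intro card_subset_eq) auto
  \<comment> \<open>Pairing \<open>u\<close> with the partner basis vector isolates a single
    coordinate, up to sign and the nonzero factor \<open>a\<close>.\<close>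
  moreover have "u $ i = 0" "u $ j = 0" "u $ k = 0" "u $ l = 0"
    using u[rule_format, of "ee j"] u[rule_format, of "ee i"]
      u[rule_format, of "ee l"] u[rule_format, of "ee k"] assms(1,2)
    by (simp_all add: darboux_4_def axis_def)
  ultimately show "u = 0" by (auto simp: vec_eq_iff set_eq_iff)
qed (use assms(3) in \<open>simp_all add: darboux_4_def\<close>)

lemma symplectic_form_rr'_3_0: "symplectic_form rr'_3_0 (darboux_4 1 4 1 2 3)"
  by (rule symplectic_form_darboux_4) (simp_all add: darboux_4_def bracket_nth algebra_simps)

lemma symplectic_form_n_4: "symplectic_form n_4 (darboux_4 1 2 1 3 4)"
  by (rule symplectic_form_darboux_4) (simp_all add: darboux_4_def bracket_nth algebra_simps)

lemma symplectic_form_r'_4_0: "symplectic_form (r'_4_0 \<delta>) (darboux_4 1 4 1 2 3)"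
  by (rule symplectic_form_darboux_4) (simp_all add: darboux_4_def bracket_nth algebra_simps)

text \<open>For \<open>d'_4\<close> this form is the exact form \<open>- de\<^sup>3\<close>.\<close>

lemma symplectic_form_d'_4:
  "\<delta> \<noteq> 0 \<Longrightarrow> symplectic_form (d'_4 \<delta>) (darboux_4 1 2 (- \<delta>) 3 4)"
  by (rule symplectic_form_darboux_4) (simp_all add: darboux_4_def bracket_nth algebra_simps)

section \<open>Exclusion of para-Kaehler structures on the four algebras\<close>

text \<open>The equations make \<open>(x, y)\<close> an eigenvector, for the real eigenvalue
  \<open>c\<close>, of \<open>a\<close> times a quarter turn, whose eigenvalues are the non-real
  numbers \<open>a i\<close> and \<open>- a i\<close>.\<close>

lemma real_rotation_no_eigenvector:
  fixes a c x y :: real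
  assumes "a * y = c * x" "- a * x = c * y" "a \<noteq> 0"
  shows "x = 0 \<and> y = 0"
proof -
  have "a * (x\<^sup>2 + y\<^sup>2) = y * (a * y) - x * (- a * x)" by algebra
  also have "\<dots> = 0" unfolding assms by simp
  finally show ?thesis using assms(3) by (simp add: sum_power2_eq_zero_iff)
qed

lemma vec4_expand: "v = v $ 1 *\<^sub>R ee 1 + v $ 2 *\<^sub>R ee 2 + v $ 3 *\<^sub>R ee 3 + v $ 4 *\<^sub>R ee 4"
  by (simp add: vec_eq_iff forall_4 axis_def)

text \<open>Expanding the first argument turns closedness at triples of basis vectors into linear
  equations between the numbers \<open>\<omega> (ee i) (ee j)\<close>.\<close>

lemma symplectic_form_basis:
  fixes br :: "real ^ 4 \<Rightarrow> real ^ 4 \<Rightarrow> real ^ 4"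
  assumes "symplectic_form br \<omega>"
  shows "\<omega> u w = u $ 1 * \<omega> (ee 1) w + u $ 2 * \<omega> (ee 2) w + u $ 3 * \<omega> (ee 3) w + u $ 4 * \<omega> (ee 4) w"
    and "\<omega> u u = 0" and "\<omega> u w = - \<omega> w u"
    and "\<omega> (br u v) w + \<omega> (br v w) u + \<omega> (br w u) v = 0"
proof -
  have bil: "bilinear \<omega>" using assms by (simp add: symplectic_form_def)
  show "\<omega> u w = u $ 1 * \<omega> (ee 1) w + u $ 2 * \<omega> (ee 2) w + u $ 3 * \<omega> (ee 3) w + u $ 4 * \<omega> (ee 4) w"
    by (subst (1) vec4_expand[of u]) (simp add: bilinear_ladd[OF bil] bilinear_lmul[OF bil])
  show "\<omega> u u = 0" using assms by (simp add: symplectic_form_def)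
  show "\<omega> u w = - \<omega> w u" by (rule symplectic_form_antisym[OF assms])
  show "\<omega> (br u v) w + \<omega> (br v w) u + \<omega> (br w u) v = 0"
    using assms by (simp add: symplectic_form_def)
qed

text \<open>Here \<open>ee 4\<close> is central, so closedness at a triple containing it and
  \<open>ee 1\<close> has just one nonzero term. On the ideal, \<open>ad u\<close> kills
  \<open>ee 4\<close> and acts on the plane of \<open>ee 2\<close> and \<open>ee 3\<close> as
  \<open>u $ 1\<close> times a quarter turn.\<close>

lemma not_para_kahler_rr'_3_0: "\<not> (\<exists>\<omega> K. para_kahler rr'_3_0 \<omega> K)"
proof (rule not_para_kahler_4[where i = 1 and ?z0.0 = "ee 4"])
  fix \<omega> and v :: "real ^ 4" assume \<omega>: "symplectic_form rr'_3_0 \<omega>" and v: "v $ 1 = 0"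
  note E = symplectic_form_basis[OF \<omega>]
  have "\<omega> (ee 2) (ee 4) = 0" "\<omega> (ee 3) (ee 4) = 0"
    using E(4)[of "ee 1" "ee 3" "ee 4"] E(4)[of "ee 1" "ee 2" "ee 4"]
    by (simp_all add: E(1)[of "rr'_3_0 _ _"] bracket_nth axis_def)
  then show "\<omega> v (ee 4) = 0" using v by (simp add: E(1)[of v] E(2))
next
  fix u z :: "real ^ 4" and c assume "u $ 1 \<noteq> 0" "z $ 1 = 0" "rr'_3_0 u z = c *\<^sub>R z"
  then have "z $ 2 = 0 \<and> z $ 3 = 0"
    by (intro real_rotation_no_eigenvector[of "u $ 1" _ c])
       (auto simp: vec_eq_iff forall_4 bracket_nth)
  then show "\<exists>k. z = k *\<^sub>R ee 4"
    using \<open>z $ 1 = 0\<close> by (intro exI[of _ "z $ 4"]) (simp add: vec_eq_iff forall_4 axis_def)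
qed (simp_all add: bracket_nth)

text \<open>On the ideal, \<open>ad u\<close> is \<open>u $ 4\<close> times the nilpotent shift from
  \<open>ee 1\<close> to \<open>ee 2\<close> to \<open>ee 3\<close>. Being a single Jordan block, it
  has only the eigenline of \<open>ee 3\<close>.\<close>

lemma not_para_kahler_n_4: "\<not> (\<exists>\<omega> K. para_kahler n_4 \<omega> K)"
proof (rule not_para_kahler_4[where i = 4 and ?z0.0 = "ee 3"])
  fix \<omega> and v :: "real ^ 4" assume \<omega>: "symplectic_form n_4 \<omega>" and v: "v $ 4 = 0"
  note E = symplectic_form_basis[OF \<omega>]
  have "\<omega> (ee 2) (ee 3) = 0" "\<omega> (ee 1) (ee 3) = 0"
    using E(4)[of "ee 4" "ee 1" "ee 3"] E(4)[of "ee 4" "ee 2" "ee 1"] E(3)[of "ee 1" "ee 3"]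
    by (simp_all add: E(1)[of "n_4 _ _"] E(2) bracket_nth axis_def)
  then show "\<omega> v (ee 3) = 0" using v by (simp add: E(1)[of v] E(2))
next
  fix u z :: "real ^ 4" and c assume "u $ 4 \<noteq> 0" "z $ 4 = 0" "n_4 u z = c *\<^sub>R z"
  then have "z $ 1 = 0 \<and> z $ 2 = 0"
    by (auto simp: vec_eq_iff forall_4 bracket_nth)
  then show "\<exists>k. z = k *\<^sub>R ee 3"
    using \<open>z $ 4 = 0\<close> by (intro exI[of _ "z $ 3"]) (simp add: vec_eq_iff forall_4 axis_def)
qed (simp_all add: bracket_nth)

lemma not_para_kahler_r'_4_0:
  assumes "\<delta> \<noteq> 0"
  shows "\<not> (\<exists>\<omega> K. para_kahler (r'_4_0 \<delta>) \<omega> K)"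
proof (rule not_para_kahler_4[where i = 4 and ?z0.0 = "ee 1"])
  fix \<omega> and v :: "real ^ 4" assume \<omega>: "symplectic_form (r'_4_0 \<delta>) \<omega>" and v: "v $ 4 = 0"
  note E = symplectic_form_basis[OF \<omega>]
  have "\<omega> (ee 2) (ee 1) = 0 \<and> \<omega> (ee 3) (ee 1) = 0"
    using E(4)[of "ee 4" "ee 1" "ee 2"] E(4)[of "ee 4" "ee 1" "ee 3"]
      E(3)[of "ee 1" "ee 2"] E(3)[of "ee 1" "ee 3"]
    \<comment> \<open>The eigenvalue 1 comes from \<open>[e\<^sub>4, e\<^sub>1] = e\<^sub>1\<close>,
      the factor \<delta> from the rotation in the plane of \<open>ee 2\<close> and
      \<open>ee 3\<close>.\<close>
    by (intro real_rotation_no_eigenvector[of \<delta> _ 1])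
       (use assms in \<open>simp_all add: E(1)[of "r'_4_0 _ _ _"] bracket_nth axis_def\<close>)
  then show "\<omega> v (ee 1) = 0" using v by (simp add: E(1)[of v] E(2))
next
  fix u z :: "real ^ 4" and c assume "u $ 4 \<noteq> 0" "z $ 4 = 0" "r'_4_0 \<delta> u z = c *\<^sub>R z"
  then have "z $ 2 = 0 \<and> z $ 3 = 0"
    using assms by (intro real_rotation_no_eigenvector[of "\<delta> * u $ 4" _ c])
       (auto simp: vec_eq_iff forall_4 bracket_nth)
  then show "\<exists>k. z = k *\<^sub>R ee 1"
    using \<open>z $ 4 = 0\<close> by (intro exI[of _ "z $ 1"]) (simp add: vec_eq_iff forall_4 axis_def)
qed (simp_all add: bracket_nth)

text \<open>The ideal is a Heisenberg algebra with centre spanned by \<open>ee 3\<close>. Modulo the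
  centre, \<open>ad u\<close> is \<open>u $ 4\<close> times the sum of \<delta>/2 times the identity
  and a quarter turn, so it has no real eigenvector there.\<close>

lemma not_para_kahler_d'_4: "\<not> (\<exists>\<omega> K. para_kahler (d'_4 \<delta>) \<omega> K)"
proof (rule not_para_kahler_4[where i = 4 and ?z0.0 = "ee 3"])
  fix \<omega> and v :: "real ^ 4" assume \<omega>: "symplectic_form (d'_4 \<delta>) \<omega>" and v: "v $ 4 = 0"
  note E = symplectic_form_basis[OF \<omega>]
  have "\<omega> (ee 1) (ee 3) = 0 \<and> \<omega> (ee 2) (ee 3) = 0"
    using E(4)[of "ee 4" "ee 1" "ee 3"] E(4)[of "ee 4" "ee 2" "ee 3"]
      E(3)[of "ee 3" "ee 1"] E(3)[of "ee 3" "ee 2"]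
    \<comment> \<open>The constant is \<delta>/2 + \<delta>: the scaling of \<open>ad (ee 4)\<close>
      on the plane of \<open>ee 1\<close> and \<open>ee 2\<close> plus its eigenvalue on
      \<open>ee 3\<close>.\<close>
    by (intro real_rotation_no_eigenvector[of 1 _ "3 * \<delta> / 2"])
       (simp_all add: E(1)[of "d'_4 _ _ _"] E(2) bracket_nth axis_def)
  then show "\<omega> v (ee 3) = 0" using v by (simp add: E(1)[of v] E(2))
next
  fix u z :: "real ^ 4" and c assume "u $ 4 \<noteq> 0" "z $ 4 = 0" "d'_4 \<delta> u z = c *\<^sub>R z"
  then have "z $ 1 = 0 \<and> z $ 2 = 0"
    \<comment> \<open>Moving the scalar part \<delta>/2 times \<open>u $ 4\<close> to the eigenvalue
      side leaves a pure rotation.\<close>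
    by (intro real_rotation_no_eigenvector[of "u $ 4" _ "c - \<delta> / 2 * u $ 4"])
       (auto simp: vec_eq_iff forall_4 bracket_nth algebra_simps)
  then show "\<exists>k. z = k *\<^sub>R ee 3"
    using \<open>z $ 4 = 0\<close> by (intro exI[of _ "z $ 3"]) (simp add: vec_eq_iff forall_4 axis_def)
qed (simp_all add: bracket_nth)

theorem corollary1p1:
  shows
    "(lie_algebra rr'_3_0 \<and> (\<exists>\<omega>. symplectic_form rr'_3_0 \<omega>) \<and>
        \<not> (\<exists>\<omega> K. para_kahler rr'_3_0 \<omega> K)) \<and>
     (lie_algebra n_4 \<and> (\<exists>\<omega>. symplectic_form n_4 \<omega>) \<and>
        \<not> (\<exists>\<omega> K. para_kahler n_4 \<omega> K)) \<and>
     (\<forall>\<delta>>0. lie_algebra (r'_4_0 \<delta>) \<and> (\<exists>\<omega>. symplectic_form (r'_4_0 \<delta>) \<omega>) \<and>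
        \<not> (\<exists>\<omega> K. para_kahler (r'_4_0 \<delta>) \<omega> K)) \<and>
     (\<forall>\<delta>>0. lie_algebra (d'_4 \<delta>) \<and> (\<exists>\<omega>. symplectic_form (d'_4 \<delta>) \<omega>) \<and>
        \<not> (\<exists>\<omega> K. para_kahler (d'_4 \<delta>) \<omega> K))"
  by (intro conjI allI impI exI)
    (rule lie_algebra_rr'_3_0 symplectic_form_rr'_3_0 not_para_kahler_rr'_3_0
      lie_algebra_n_4 symplectic_form_n_4 not_para_kahler_n_4
      lie_algebra_r'_4_0 symplectic_form_r'_4_0 not_para_kahler_r'_4_0
      lie_algebra_d'_4 symplectic_form_d'_4 not_para_kahler_d'_4; simp)+

end
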